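(* Let $K$ be a field of characteristic $0$. (a) A polynomial $p \in K[x,y]$ generates a retract of $K[x,y]$ (i.e. $K[p]$ is a retract of $K[x,y]$) if and only if there is a polynomial mapping $\varphi$ of $K[x,y]$ with $\varphi(p) = x$. (b) The "if" part is valid for a polynomial algebra in arbitrarily many variables: if $p \in K[x_1,\dots,x_n]$ and there is a polynomial mapping $\varphi$ of $K[x_1,\dots,x_n]$ with $\varphi(p) = x_1$, then $K[p]$ is a retract of $K[x_1,\dots,x_n]$.
   Context: A polynomial mapping of a polynomial algebra $A = K[x_1,\dots,x_n]$ is a $K$-algebra endomorphism of $A$. A $K$-subalgebra $R$ of $A$ is called a retract if there is an idempotent $K$-algebra endomorphism $\pi$ of $A$ with $\pi(A) = R$. $K[p]$ denotes the $K$-subalgebra generated by $p$.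
   Formalization: In (a), p is assumed non-constant: for constant p, K[p] = K is a retract (send x and y to 0), yet every polynomial mapping fixes p, so none sends p to x. *)

theory Defs
  imports "HOL-Library.Poly_Mapping"
begin

text \<open>
  Polynomials with coefficients in \<open>'k\<close> and variables indexed by \<open>nat\<close> are finitely supported
  maps from monomials (finitely supported exponent vectors) to coefficients; the ring structure
  on this type is the convolution product of \<^theory>\<open>HOL-Library.Poly_Mapping\<close>. The algebra
  \<open>K[x\<^sub>1, \<dots>, x\<^sub>n]\<close> is the set \<open>mpolys n\<close> of polynomials involving only the variables with index
  below \<open>n\<close>, so that \<open>x\<^sub>j\<close> is \<open>Var (j - 1)\<close>.
\<close>

type_synonym 'k mpoly = "(nat \<Rightarrow>\<^sub>0 nat) \<Rightarrow>\<^sub>0 'k"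

definition mpolys :: "nat \<Rightarrow> 'k::comm_ring_1 mpoly set" where
  "mpolys n = {p. \<forall>m \<in> Poly_Mapping.keys p. Poly_Mapping.keys m \<subseteq> {..<n}}"

definition Const :: "'k \<Rightarrow> 'k::comm_ring_1 mpoly" where
  "Const c = Poly_Mapping.single 0 c"

definition Var :: "nat \<Rightarrow> 'k::comm_ring_1 mpoly" where
  "Var i = Poly_Mapping.single (Poly_Mapping.single i 1) 1"

text \<open>
  A polynomial mapping is a \<open>K\<close>-algebra endomorphism of \<open>mpolys n\<close>; its values outside
  \<open>mpolys n\<close> are irrelevant. Scalar multiplication by \<open>c\<close> is multiplication by \<open>Const c\<close>.
\<close>

definition polynomial_mapping :: "nat \<Rightarrow> ('k::comm_ring_1 mpoly \<Rightarrow> 'k mpoly) \<Rightarrow> bool" where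
  "polynomial_mapping n f \<longleftrightarrow>
     (\<forall>p \<in> mpolys n. f p \<in> mpolys n) \<and>
     (\<forall>p \<in> mpolys n. \<forall>q \<in> mpolys n. f (p + q) = f p + f q) \<and>
     (\<forall>p \<in> mpolys n. \<forall>q \<in> mpolys n. f (p * q) = f p * f q) \<and>
     (\<forall>c. \<forall>p \<in> mpolys n. f (Const c * p) = Const c * f p) \<and>
     f 1 = 1"

definition subalgebra :: "nat \<Rightarrow> 'k::comm_ring_1 mpoly set \<Rightarrow> bool" where
  "subalgebra n R \<longleftrightarrow>
     R \<subseteq> mpolys n \<and> 1 \<in> R \<and>
     (\<forall>p \<in> R. \<forall>q \<in> R. p + q \<in> R) \<and>
     (\<forall>p \<in> R. \<forall>q \<in> R. p * q \<in> R) \<and>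
     (\<forall>c. \<forall>p \<in> R. Const c * p \<in> R)"

definition generated_subalgebra :: "nat \<Rightarrow> 'k::comm_ring_1 mpoly \<Rightarrow> 'k mpoly set" where
  "generated_subalgebra n p = \<Inter> {R. subalgebra n R \<and> p \<in> R}"

text \<open>
  Pitfall: for constant \<open>p\<close> the generated subalgebra is the field of constants, which is a retract
  (map all variables to 0), although no polynomial mapping sends \<open>p\<close> to a variable. Hence the
  characterization of retracts generated by one polynomial concerns non-constant \<open>p\<close>.
\<close>

definition retract :: "nat \<Rightarrow> 'k::comm_ring_1 mpoly set \<Rightarrow> bool" where
  "retract n R \<longleftrightarrow>
     subalgebra n R \<and>
     (\<exists>\<pi>. polynomial_mapping n \<pi> \<and> (\<forall>p \<in> mpolys n. \<pi> (\<pi> p) = \<pi> p) \<and> \<pi> ` mpolys n = R)"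

end

theory Submission
  imports Defs "HOL-Computational_Algebra.Polynomial"
begin

text \<open>
  Write \<open>A = K[x\<^sub>1, \<dots>, x\<^sub>n]\<close>. Both directions rest on the universal property of \<open>A\<close>: a polynomial
  mapping is determined by its values on the variables, and these may be prescribed freely
  (\<open>polynomial_mapping_eqI\<close>, \<open>polynomial_mapping_subst\<close>).

  If \<open>\<phi> p = x\<^sub>1\<close>, let \<open>\<sigma>\<close> be the polynomial mapping that sends every variable to \<open>p\<close>. Then
  \<open>\<sigma> \<circ> \<phi>\<close> takes its values in \<open>K[p]\<close> and fixes \<open>p\<close>, hence all of \<open>K[p]\<close>, so it is an idempotent
  endomorphism with image \<open>K[p]\<close>.

  Conversely, let \<open>\<pi>\<close> be a retraction onto \<open>K[p]\<close>. Then \<open>\<pi> p = p\<close>, and \<open>\<pi> x\<^sub>i = a\<^sub>i(p)\<close> for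
  univariate polynomials \<open>a\<^sub>i\<close>, so \<open>p(a\<^sub>1(p), \<dots>, a\<^sub>n(p)) = p\<close>. A non-constant \<open>p\<close> is transcendental
  over the constants (\<open>aeval_eq_0_iff\<close>), so \<open>p\<close> may be replaced by an indeterminate in this
  identity: \<open>p(a\<^sub>1(t), \<dots>, a\<^sub>n(t)) = t\<close>. Therefore \<open>x\<^sub>i \<mapsto> a\<^sub>i(x\<^sub>1)\<close> defines a polynomial mapping that
  sends \<open>p\<close> to \<open>x\<^sub>1\<close>.
\<close>

section \<open>Polynomials in finitely many variables as a subalgebra\<close>

lemma Const_simps [simp]:
  "Const 0 = 0" "Const 1 = 1" "Const (a + b) = Const a + Const b" "Const (a * b) = Const a * Const b"
  by (simp_all add: Const_def single_add mult_single)

lemma Const_eq_0_iff [simp]: "Const c = 0 \<longleftrightarrow> c = 0"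
  by (metis Const_def lookup_single_eq lookup_zero single_zero)

lemma subalgebra_mpolys: "subalgebra n (mpolys n)"
proof -
  have mult: "p * q \<in> mpolys n" if "p \<in> mpolys n" "q \<in> mpolys n" for p q :: "'a mpoly"
  proof -
    have "Poly_Mapping.keys m \<subseteq> {..<n}" if m: "m \<in> Poly_Mapping.keys (p * q)" for m
    proof -
      obtain a b where "m = a + b" "a \<in> Poly_Mapping.keys p" "b \<in> Poly_Mapping.keys q"
        using m keys_mult[of p q] by auto
      then show ?thesis
        using \<open>p \<in> mpolys n\<close> \<open>q \<in> mpolys n\<close> keys_add[of a b] unfolding mpolys_def by blast
    qed
    then show ?thesis by (simp add: mpolys_def)
  qed
  moreover have "p + q \<in> mpolys n" if "p \<in> mpolys n" "q \<in> mpolys n" for p q :: "'a mpoly"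
    using that keys_add[of p q] unfolding mpolys_def by blast
  moreover have "Const c \<in> mpolys n" for c :: 'a
    by (simp add: mpolys_def Const_def)
  moreover have "1 \<in> mpolys n" by (simp add: mpolys_def)
  ultimately show ?thesis
    unfolding subalgebra_def by blast
qed

lemma Var_in_mpolys: "i < n \<Longrightarrow> Var i \<in> mpolys n"
  by (simp add: mpolys_def Var_def)

lemma subalgebra_Const:
  assumes "subalgebra n R"
  shows "Const c \<in> R"
  using assms unfolding subalgebra_def by (metis mult.right_neutral)

lemma subalgebra_sum:
  assumes "subalgebra n R" "\<And>x. x \<in> S \<Longrightarrow> f x \<in> R"
  shows "sum f S \<in> R"
  using assms(2)
proof (induction S rule: infinite_finite_induct)
  case (insert x S)
  then show ?case using assms(1) by (auto simp: subalgebra_def)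
qed (use subalgebra_Const[OF assms(1), of 0] in auto)

lemma subalgebra_prod:
  assumes "subalgebra n R" "\<And>x. x \<in> S \<Longrightarrow> f x \<in> R"
  shows "prod f S \<in> R"
  using assms(2)
proof (induction S rule: infinite_finite_induct)
  case (insert x S)
  then show ?case using assms(1) by (auto simp: subalgebra_def)
qed (use subalgebra_Const[OF assms(1), of 1] in auto)

lemma subalgebra_power:
  assumes "subalgebra n R" "r \<in> R"
  shows "r ^ k \<in> R"
  by (induction k) (use assms in \<open>auto simp: subalgebra_def\<close>)

section \<open>Substitution and the universal property\<close>

definition monom_subst :: "(nat \<Rightarrow> 'k mpoly) \<Rightarrow> (nat \<Rightarrow>\<^sub>0 nat) \<Rightarrow> 'k::comm_ring_1 mpoly" where
  "monom_subst g m = (\<Prod>i\<in>Poly_Mapping.keys m. g i ^ Poly_Mapping.lookup m i)"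

definition subst :: "(nat \<Rightarrow> 'k mpoly) \<Rightarrow> 'k mpoly \<Rightarrow> 'k::comm_ring_1 mpoly" where
  "subst g p = (\<Sum>m\<in>Poly_Mapping.keys p. Const (Poly_Mapping.lookup p m) * monom_subst g m)"

lemma monom_subst_superset:
  assumes "finite S" "Poly_Mapping.keys m \<subseteq> S"
  shows "monom_subst g m = (\<Prod>i\<in>S. g i ^ Poly_Mapping.lookup m i)"
  unfolding monom_subst_def
  by (rule prod.mono_neutral_left) (use assms in \<open>auto simp: in_keys_iff\<close>)

lemma monom_subst_add: "monom_subst g (a + b) = monom_subst g a * monom_subst g b"
proof -
  let ?S = "Poly_Mapping.keys a \<union> Poly_Mapping.keys b"
  have "monom_subst g c = (\<Prod>i\<in>?S. g i ^ Poly_Mapping.lookup c i)" if "c \<in> {a, b, a + b}" for c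
    by (rule monom_subst_superset) (use that keys_add[of a b] in auto)
  then show ?thesis
    by (simp add: lookup_add power_add prod.distrib)
qed

lemma subst_single: "subst g (Poly_Mapping.single m c) = Const c * monom_subst g m"
  by (simp add: subst_def)

lemma subst_add: "subst g (p + q) = subst g p + subst g q"
  unfolding subst_def by (rule setsum_keys_plus_distrib) (simp_all add: distrib_right)

lemma subst_sum: "subst g (sum f S) = (\<Sum>x\<in>S. subst g (f x))"
proof -
  have "subst g 0 = 0" by (simp add: subst_def)
  then show ?thesis
    by (induction S rule: infinite_finite_induct) (simp_all add: subst_add)
qed

lemma sum_single_keys:
  "(\<Sum>m\<in>Poly_Mapping.keys p. Poly_Mapping.single m (Poly_Mapping.lookup p m)) = p"
proof (rule poly_mapping_eqI)
  fix k
  have "Poly_Mapping.lookup (\<Sum>m\<in>Poly_Mapping.keys p. Poly_Mapping.single m (Poly_Mapping.lookup p m)) k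
      = (\<Sum>m\<in>Poly_Mapping.keys p. if m = k then Poly_Mapping.lookup p m else 0)"
    by (simp add: lookup_sum lookup_single when_def)
  also have "\<dots> = Poly_Mapping.lookup p k"
    by (auto simp: in_keys_iff)
  finally show "Poly_Mapping.lookup (\<Sum>m\<in>Poly_Mapping.keys p.
      Poly_Mapping.single m (Poly_Mapping.lookup p m)) k = Poly_Mapping.lookup p k" .
qed

lemma subst_mult: "subst g (p * q) = subst g p * subst g q"
proof -
  let ?s = "\<lambda>p m. Poly_Mapping.single m (Poly_Mapping.lookup p m)"
  have "subst g (p * q) = subst g ((\<Sum>a\<in>Poly_Mapping.keys p. ?s p a) * (\<Sum>b\<in>Poly_Mapping.keys q. ?s q b))"
    by (simp add: sum_single_keys)
  also have "\<dots> = (\<Sum>a\<in>Poly_Mapping.keys p. \<Sum>b\<in>Poly_Mapping.keys q. subst g (?s p a) * subst g (?s q b))"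
    by (simp add: sum_product subst_sum mult_single subst_single monom_subst_add mult_ac)
  also have "\<dots> = subst g p * subst g q"
    by (simp add: subst_def[of g p] subst_def[of g q] sum_product subst_single)
  finally show ?thesis .
qed

lemma subst_Const: "subst g (Const c) = Const c"
  by (simp add: Const_def subst_single monom_subst_def)

lemma subst_Var: "subst g (Var i) = g i"
  by (simp add: Var_def subst_single monom_subst_def)

lemma subst_in_subalgebra:
  assumes "subalgebra n R" "\<And>i. i < k \<Longrightarrow> g i \<in> R" "p \<in> mpolys k"
  shows "subst g p \<in> R"
proof -
  have "monom_subst g m \<in> R" if "m \<in> Poly_Mapping.keys p" for m
    unfolding monom_subst_def using that assms
    by (intro subalgebra_prod[OF assms(1)] subalgebra_power[OF assms(1)]) (auto simp: mpolys_def)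
  then show ?thesis
    unfolding subst_def using assms(1) by (intro subalgebra_sum[OF assms(1)]) (auto simp: subalgebra_def)
qed

text \<open>
  Existence in the universal property: the values on the variables can be prescribed.
\<close>

lemma polynomial_mapping_subst:
  assumes "\<And>i. i < n \<Longrightarrow> g i \<in> mpolys n"
  shows "polynomial_mapping n (subst g)"
  using subst_in_subalgebra[OF subalgebra_mpolys assms] subst_Const[of g 1]
  by (simp add: polynomial_mapping_def subst_add subst_mult subst_Const)

lemma subst_Var_eq: "subst Var p = p"
proof -
  have pow: "Var i ^ k = (Poly_Mapping.single (Poly_Mapping.single i k) 1 :: 'a mpoly)" for i k
    by (induction k) (simp_all add: Var_def mult_single flip: single_add)
  have prod: "(\<Prod>i\<in>S. Poly_Mapping.single (f i) 1) = (Poly_Mapping.single (sum f S) 1 :: 'a mpoly)"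
    for f :: "nat \<Rightarrow> (nat \<Rightarrow>\<^sub>0 nat)" and S
    by (induction S rule: infinite_finite_induct) (simp_all add: mult_single)
  have "monom_subst Var m = (Poly_Mapping.single m 1 :: 'a mpoly)" for m
    by (simp add: monom_subst_def pow prod sum_single_keys)
  then show ?thesis
    by (simp add: subst_def Const_def mult_single sum_single_keys)
qed

text \<open>
  This is the induction principle for \<open>mpolys n\<close>: a property that defines a subalgebra need only be
  checked on the variables.
\<close>

lemma mpolys_subset_subalgebra:
  fixes R :: "'a::comm_ring_1 mpoly set"
  assumes "subalgebra k R" "\<And>i. i < n \<Longrightarrow> Var i \<in> R"
  shows "mpolys n \<subseteq> R"
proof
  fix p :: "'a mpoly" assume "p \<in> mpolys n"
  then have "subst Var p \<in> R"
    using subst_in_subalgebra[OF assms(1), of n Var p] assms(2) by blast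
  then show "p \<in> R" by (simp add: subst_Var_eq)
qed

text \<open>
  Applied to a pair of polynomial mappings, this gives uniqueness in the universal property. Applied
  to one of them and the identity, it shows that a mapping that fixes \<open>p\<close> fixes \<open>K[p]\<close>.
\<close>

lemma subalgebra_equalizer:
  assumes "polynomial_mapping n f" "polynomial_mapping n g"
  shows "subalgebra n {p \<in> mpolys n. f p = g p}"
  using assms subalgebra_mpolys[of n] unfolding polynomial_mapping_def subalgebra_def by auto

lemma polynomial_mapping_eqI:
  assumes "polynomial_mapping n f" "polynomial_mapping n g" "\<And>i. i < n \<Longrightarrow> f (Var i) = g (Var i)"
    and "p \<in> mpolys n"
  shows "f p = g p"
  using mpolys_subset_subalgebra[OF subalgebra_equalizer[OF assms(1,2)], of n] assms(3,4)
  by (auto simp: Var_in_mpolys)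

lemma polynomial_mapping_id: "polynomial_mapping n (\<lambda>p. p)"
  by (simp add: polynomial_mapping_def)

lemma polynomial_mapping_comp:
  assumes "polynomial_mapping n f" "polynomial_mapping n g"
  shows "polynomial_mapping n (\<lambda>p. f (g p))"
  using assms unfolding polynomial_mapping_def by simp

section \<open>The subalgebra generated by one polynomial\<close>

lemma generated_subalgebra_least:
  assumes "subalgebra n R" "p \<in> R"
  shows "generated_subalgebra n p \<subseteq> R"
  using assms by (auto simp: generated_subalgebra_def)

lemma generator_in_generated_subalgebra: "p \<in> generated_subalgebra n p"
  by (simp add: generated_subalgebra_def)

lemma subalgebra_generated_subalgebra:
  assumes "p \<in> mpolys n"
  shows "subalgebra n (generated_subalgebra n p)"
  using generated_subalgebra_least[OF subalgebra_mpolys assms]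
  unfolding generated_subalgebra_def subalgebra_def by auto

text \<open>
  The value \<open>q(r)\<close>: since \<open>poly\<close> evaluates only at elements of the coefficient ring, the
  coefficients are first embedded by \<open>Const\<close>.
\<close>

definition aeval :: "'k poly \<Rightarrow> 'k mpoly \<Rightarrow> 'k::comm_ring_1 mpoly" where
  "aeval q r = poly (map_poly Const q) r"

lemma aeval_0 [simp]: "aeval 0 r = 0"
  by (simp add: aeval_def)

lemma aeval_pCons [simp]: "aeval (pCons c q) r = Const c + r * aeval q r"
  by (simp add: aeval_def map_poly_pCons)

lemma aeval_add: "aeval (q + q') r = aeval q r + aeval q' r"
  by (induction q q' rule: poly_induct2) (simp_all add: algebra_simps)

lemma aeval_smult: "aeval (smult c q) r = Const c * aeval q r"
  by (induction q) (simp_all add: algebra_simps)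

lemma aeval_mult: "aeval (q * q') r = aeval q r * aeval q' r"
  by (induction q) (simp_all add: algebra_simps aeval_add aeval_smult)

lemma aeval_in_subalgebra:
  assumes "subalgebra n R" "r \<in> R"
  shows "aeval q r \<in> R"
  by (induction q)
     (use assms subalgebra_Const[OF assms(1)] subalgebra_Const[OF assms(1), of 0] in \<open>auto simp: subalgebra_def\<close>)

lemma subalgebra_range_aeval:
  assumes "r \<in> mpolys n"
  shows "subalgebra n (range (\<lambda>q. aeval q r))"
proof -
  have "1 = aeval 1 r" by (simp add: one_pCons)
  then show ?thesis
    using aeval_in_subalgebra[OF subalgebra_mpolys assms]
    unfolding subalgebra_def by (auto simp flip: aeval_add aeval_smult aeval_mult)
qed

lemma generated_subalgebra_subset_range_aeval:
  assumes "r \<in> mpolys n"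
  shows "generated_subalgebra n r \<subseteq> range (\<lambda>q. aeval q r)"
proof (rule generated_subalgebra_least[OF subalgebra_range_aeval[OF assms]])
  have "r = aeval [:0, 1:] r" by simp
  then show "r \<in> range (\<lambda>q. aeval q r)" by blast
qed

lemma polynomial_mapping_aeval:
  assumes "polynomial_mapping n f" "r \<in> mpolys n"
  shows "f (aeval q r) = aeval q (f r)"
proof (induction q)
  case 0
  have "f (Const 0 * 1) = Const 0 * f 1"
    using assms(1) subalgebra_mpolys[of n] unfolding polynomial_mapping_def subalgebra_def by blast
  then show ?case by simp
next
  case (pCons c q)
  have "f (Const c * 1) = Const c * f 1" "f 1 = 1"
    using assms(1) subalgebra_mpolys[of n] unfolding polynomial_mapping_def subalgebra_def by blast+
  then have c: "f (Const c) = Const c" by simp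
  have q: "aeval q r \<in> mpolys n" "r * aeval q r \<in> mpolys n" "Const c \<in> mpolys n"
    using aeval_in_subalgebra[OF subalgebra_mpolys assms(2)] assms(2) subalgebra_mpolys[of n]
      subalgebra_Const[OF subalgebra_mpolys] by (auto simp: subalgebra_def)
  show ?case
    using assms pCons.IH q c by (simp add: polynomial_mapping_def)
qed

section \<open>Transcendence of non-constant polynomials\<close>

text \<open>
  The lexicographic order is compatible with addition of exponent vectors and has the constant
  monomial as its least element. Hence leading monomials add under multiplication, and a product
  with a non-constant factor cannot become constant unless it vanishes.
\<close>

lemma monomial_ge_0: "(0 :: nat \<Rightarrow>\<^sub>0 nat) \<le> m"
proof (rule ccontr)
  assume "\<not> 0 \<le> m"
  then have "m < 0" by simp
  then show False by transfer (simp add: less_fun_def)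
qed

lemma Max_keys_add_in_keys_mult:
  fixes p q :: "'k::idom mpoly"
  assumes "p \<noteq> 0" "q \<noteq> 0"
  shows "Max (Poly_Mapping.keys p) + Max (Poly_Mapping.keys q) \<in> Poly_Mapping.keys (p * q)"
proof -
  define M where "M = Max (Poly_Mapping.keys p)"
  define N where "N = Max (Poly_Mapping.keys q)"
  define a where "a = Poly_Mapping.lookup p M"
  define b where "b = Poly_Mapping.lookup q N"
  define p' where "p' = p - Poly_Mapping.single M a"
  define q' where "q' = q - Poly_Mapping.single N b"
  have MN: "M \<in> Poly_Mapping.keys p" "N \<in> Poly_Mapping.keys q"
    using assms by (simp_all add: M_def N_def)
  then have ab: "a \<noteq> 0" "b \<noteq> 0"
    by (simp_all add: a_def b_def in_keys_iff)
  have le: "m \<le> M" if "m \<in> Poly_Mapping.keys p" for m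
    using that by (simp add: M_def)
  have le': "m \<le> N" if "m \<in> Poly_Mapping.keys q" for m
    using that by (simp add: N_def)
  have p': "m < M" if "m \<in> Poly_Mapping.keys p'" for m
    using that le[of m] by (cases "m = M") (auto simp: p'_def in_keys_iff lookup_minus lookup_single a_def when_def)
  have q': "m < N" if "m \<in> Poly_Mapping.keys q'" for m
    using that le'[of m] by (cases "m = N") (auto simp: q'_def in_keys_iff lookup_minus lookup_single b_def when_def)
  \<comment> \<open>Split off the leading terms: every monomial in the bracket is strictly below \<open>M + N\<close>.\<close>
  have "p * q = Poly_Mapping.single (M + N) (a * b) + (Poly_Mapping.single M a * q' + p' * q)"
    by (simp add: p'_def q'_def algebra_simps mult_single)
  moreover have "M + N \<notin> Poly_Mapping.keys (Poly_Mapping.single M a * q')"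
    using keys_mult[of "Poly_Mapping.single M a" q'] q' ab by fastforce
  moreover have "M + N \<notin> Poly_Mapping.keys (p' * q)"
  proof
    assume "M + N \<in> Poly_Mapping.keys (p' * q)"
    then obtain m m' where "M + N = m + m'" "m \<in> Poly_Mapping.keys p'" "m' \<in> Poly_Mapping.keys q"
      using keys_mult[of p' q] by auto
    then show False
      using add_less_le_mono[OF p' le', of m m'] by simp
  qed
  ultimately have "Poly_Mapping.lookup (p * q) (M + N) = a * b"
    by (simp add: lookup_add in_keys_iff)
  then show ?thesis
    using ab by (simp add: in_keys_iff flip: M_def N_def)
qed

lemma mult_nonconstant:
  fixes p q :: "'k::idom mpoly"
  assumes "p \<notin> range Const" "q \<noteq> 0"
  shows "p * q \<notin> range Const"
proof
  assume "p * q \<in> range Const"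
  have "p \<noteq> 0"
    using assms(1) by (metis Const_simps(1) rangeI)
  then have "Max (Poly_Mapping.keys p) + Max (Poly_Mapping.keys q) = 0"
    using Max_keys_add_in_keys_mult[of p q] assms(2) \<open>p * q \<in> range Const\<close>
    by (auto simp: Const_def split: if_splits)
  moreover have "Max (Poly_Mapping.keys p) \<le> Max (Poly_Mapping.keys p) + Max (Poly_Mapping.keys q)"
    using add_left_mono[OF monomial_ge_0[of "Max (Poly_Mapping.keys q)"], of "Max (Poly_Mapping.keys p)"]
    by simp
  ultimately have "m = 0" if "m \<in> Poly_Mapping.keys p" for m
    using monomial_ge_0[of m] Max_ge[OF finite_keys that] by (metis order.antisym order.trans)
  then have "p = Const (Poly_Mapping.lookup p 0)"
    unfolding Const_def
    by (intro poly_mapping_eqI) (auto simp: lookup_single when_def in_keys_iff)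
  then show False using assms(1) by blast
qed

text \<open>
  A non-constant \<open>r\<close> is transcendental over the constants, by Horner's rule: if \<open>q(r) \<noteq> 0\<close> then
  \<open>r q(r)\<close> is non-constant by \<open>mult_nonconstant\<close>, so adding a constant to it cannot give 0.
\<close>

lemma aeval_eq_0_iff:
  fixes r :: "'k::idom mpoly"
  assumes "r \<notin> range Const"
  shows "aeval q r = 0 \<longleftrightarrow> q = 0"
proof (induction q)
  case (pCons c q)
  show ?case
  proof (cases "q = 0")
    case False
    with pCons have "r * aeval q r \<notin> range Const"
      using mult_nonconstant[OF assms] by simp
    moreover have "- Const c \<in> range Const"
      by (rule image_eqI[of _ _ "- c"]) (simp_all add: Const_def single_uminus)
    ultimately have "Const c + r * aeval q r \<noteq> 0"
      by (metis add_eq_0_iff)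
    with False show ?thesis by simp
  qed (use pCons in auto)
qed simp

lemma aeval_inject:
  fixes r :: "'k::idom mpoly"
  assumes "r \<notin> range Const" "aeval q r = aeval q' r"
  shows "q = q'"
proof -
  have "aeval (q - q') r + aeval q' r = aeval q r"
    by (simp flip: aeval_add)
  with assms show ?thesis
    by (simp add: aeval_eq_0_iff)
qed

section \<open>Retracts generated by one polynomial\<close>

text \<open>
  The retraction is \<open>\<phi>\<close> followed by a specialization of \<open>x\<^sub>1\<close> to \<open>p\<close>. What happens to the other
  variables is immaterial as long as they land in \<open>K[p]\<close>; sending them to \<open>p\<close> as well keeps the
  substitution uniform.
\<close>

lemma retract_if_mapped_to_Var:
  assumes "n \<ge> 1" "p \<in> mpolys n" "polynomial_mapping n \<phi>" "\<phi> p = Var 0"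
  shows "retract n (generated_subalgebra n p)"
proof -
  define \<pi> where "\<pi> f = subst (\<lambda>_. p) (\<phi> f)" for f
  let ?R = "generated_subalgebra n p"
  have R: "subalgebra n ?R"
    by (rule subalgebra_generated_subalgebra[OF assms(2)])
  have pm: "polynomial_mapping n \<pi>"
    unfolding \<pi>_def using assms(2)
    by (intro polynomial_mapping_comp[OF _ assms(3)] polynomial_mapping_subst)
  have into: "\<pi> f \<in> ?R" if "f \<in> mpolys n" for f
    unfolding \<pi>_def using that assms(3)
    by (intro subst_in_subalgebra[OF R, of n])
       (auto simp: polynomial_mapping_def generator_in_generated_subalgebra)
  have "\<pi> p = p"
    by (simp add: \<pi>_def assms(4) subst_Var)
  then have fixed: "?R \<subseteq> {f \<in> mpolys n. \<pi> f = f}"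
    using assms(2) by (intro generated_subalgebra_least subalgebra_equalizer pm polynomial_mapping_id) simp
  have "\<pi> (\<pi> f) = \<pi> f" if "f \<in> mpolys n" for f
    using into[OF that] fixed by blast
  moreover have "\<pi> ` mpolys n = ?R"
    using into fixed by force
  ultimately show ?thesis
    using R pm unfolding retract_def by blast
qed

text \<open>
  The retraction factors as \<open>\<pi> = \<sigma> \<circ> \<phi>\<close>, where \<open>\<phi>\<close> has values in \<open>K[x\<^sub>1]\<close> and \<open>\<sigma>\<close> maps \<open>x\<^sub>1\<close> to
  \<open>p\<close>. On \<open>K[x\<^sub>1]\<close> the map \<open>\<sigma>\<close> is injective because \<open>p\<close> is transcendental, so
  \<open>\<sigma> (\<phi> p) = \<pi> p = p = \<sigma> x\<^sub>1\<close> forces \<open>\<phi> p = x\<^sub>1\<close>.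
\<close>

lemma mapped_to_Var_if_retract:
  fixes p :: "'k::idom mpoly"
  assumes "n \<ge> 1" "p \<in> mpolys n" "p \<notin> range Const" "retract n (generated_subalgebra n p)"
  shows "\<exists>\<phi>. polynomial_mapping n \<phi> \<and> \<phi> p = Var 0"
proof -
  let ?R = "generated_subalgebra n p"
  obtain \<pi> where \<pi>: "polynomial_mapping n \<pi>" "\<And>f. f \<in> mpolys n \<Longrightarrow> \<pi> (\<pi> f) = \<pi> f" "\<pi> ` mpolys n = ?R"
    using assms(4) by (auto simp: retract_def)
  obtain f where "f \<in> mpolys n" "p = \<pi> f"
    using \<pi>(3) generator_in_generated_subalgebra[of p n] by blast
  with \<pi>(2) have "\<pi> p = p" by simp
  have "\<exists>q. \<pi> (Var i) = aeval q p" if "i < n" for i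
    using \<pi>(3) Var_in_mpolys[OF that] generated_subalgebra_subset_range_aeval[OF assms(2)] by blast
  then obtain a where a: "\<And>i. i < n \<Longrightarrow> \<pi> (Var i) = aeval (a i) p"
    by metis
  define \<phi> where "\<phi> = subst (\<lambda>i. aeval (a i) (Var 0))"
  define \<sigma> where "\<sigma> = subst (\<lambda>_. p)"
  have x: "(Var 0 :: 'k mpoly) \<in> mpolys n"
    using assms(1) by (intro Var_in_mpolys) simp
  have \<phi>: "polynomial_mapping n \<phi>"
    unfolding \<phi>_def by (intro polynomial_mapping_subst aeval_in_subalgebra[OF subalgebra_mpolys x])
  have \<sigma>: "polynomial_mapping n \<sigma>" "\<sigma> (Var 0) = p"
    unfolding \<sigma>_def using assms(2) by (auto intro: polynomial_mapping_subst simp: subst_Var)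
  \<comment> \<open>Both sides are polynomial mappings, so it suffices to compare them on the variables.\<close>
  have "\<sigma> (\<phi> p) = \<pi> p"
  proof (rule polynomial_mapping_eqI[OF polynomial_mapping_comp[OF \<sigma>(1) \<phi>] \<pi>(1) _ assms(2)])
    fix i assume "i < n"
    then show "\<sigma> (\<phi> (Var i)) = \<pi> (Var i)"
      using polynomial_mapping_aeval[OF \<sigma>(1) x, of "a i"] \<sigma>(2) by (simp add: \<phi>_def subst_Var a)
  qed
  moreover obtain P where P: "\<phi> p = aeval P (Var 0)"
    using subst_in_subalgebra[OF subalgebra_range_aeval[OF x] _ assms(2), of "\<lambda>i. aeval (a i) (Var 0)"]
    by (auto simp: \<phi>_def)
  ultimately have "aeval P p = aeval [:0, 1:] p"
    using polynomial_mapping_aeval[OF \<sigma>(1) x, of P] \<sigma>(2) \<open>\<pi> p = p\<close> by simp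
  then have "P = [:0, 1:]"
    by (rule aeval_inject[OF assms(3)])
  with P \<phi> show ?thesis by auto
qed

theorem corollary1p2:
  shows "(\<forall>p :: 'k::field_char_0 mpoly. p \<in> mpolys 2 \<and> p \<notin> range Const \<longrightarrow>
            (retract 2 (generated_subalgebra 2 p) \<longleftrightarrow>
             (\<exists>\<phi>. polynomial_mapping 2 \<phi> \<and> \<phi> p = Var 0)))
       \<and> (\<forall>n \<ge> 1. \<forall>p :: 'k mpoly. p \<in> mpolys n \<longrightarrow>
            (\<exists>\<phi>. polynomial_mapping n \<phi> \<and> \<phi> p = Var 0) \<longrightarrow>
            retract n (generated_subalgebra n p))"
  using retract_if_mapped_to_Var mapped_to_Var_if_retract[of 2] by (metis one_le_numeral)

end
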